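(* Consider the $L$-layer shortcut-related network $f:\mathbb{R}^d\to\mathbb{R}^{n_o}$ given by $\boldsymbol{z}^0=\boldsymbol{x}$, $\boldsymbol{z}^l=\phi(\frac{1}{\sqrt{n_l}}\mathbf{W}^l\boldsymbol{z}^{l-1})$ for $l\in[L]$, and $f(\boldsymbol{x})=\frac{1}{\sqrt{M_{\boldsymbol{z}}}}\sum_{\kappa=0}^{K}\mathbf{J}^{\kappa\hbar}\boldsymbol{z}^{\kappa\hbar}(\boldsymbol{x})$. If the activation $\phi$ is well-posed and satisfies $|\phi(\cdot)|\le 1$, and the weight matrices $\mathbf{W}^l$ are stable-pertinent for $\phi$, then for any inputs $\boldsymbol{x},\boldsymbol{x}'$ the largest singular value of $\text{NTK}_{(d)}(\boldsymbol{x},\boldsymbol{x}')$ satisfies $$\sigma_{\max}(\text{NTK}_{(d)}(\boldsymbol{x},\boldsymbol{x}'))\ \le\ \frac{K(2K+1)}{6}\,n_{\max}^2,$$ where $n_{\max}$ is the largest width of the network.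
   Context: Notation: $[L]=\{1,\dots,L\}$; $n_l$ is the width of layer $l$ ($n_0=d$); $\mathbf{W}^l\in\mathbb{R}^{n_l\times n_{l-1}}$, no biases; $\hat{\mathbf{W}}^l=\mathbf{W}^l/\sqrt{n_l}$; $\phi$ acts element-wise with derivative $\dot\phi$; $\hbar\in\mathbb{N}^+$ is the separation constant, $K\in\mathbb{N}^+$ the number of shortcut connections ($K\hbar\le L$); $\mathbf{J}^{\kappa\hbar}=[1]_{n_o\times n_{\kappa\hbar}}$ is the all-ones matrix; $M_{\boldsymbol{z}}=\sum_{\kappa=0}^K n_{\kappa\hbar}$. Well-posed: $\phi:\mathbb{R}\to\mathbb{R}$ is first-order differentiable with derivative bounded by a constant $C_\phi$. Stable-pertinent: $\mathbf{W}$ is stable-pertinent for $\phi$ if $C_\phi\|\mathbf{W}\|_s\le\epsilon$ for a constant $0<\epsilon<1$, where $\|\cdot\|_s=\sigma_{\max}(\cdot)$ is the spectral norm. Depth-induced NTK: for inputs $\boldsymbol{x},\boldsymbol{x}'$, $\text{NTK}_{(d)}(\boldsymbol{x},\boldsymbol{x}')=\sum_{\kappa'=1}^K\text{NTK}_{(d)}^{\kappa'\hbar}(\boldsymbol{x},\boldsymbol{x}')$ with $\text{NTK}_{(d)}^{\kappa'\hbar}(\boldsymbol{x},\boldsymbol{x}')=\frac{1}{M_{\boldsymbol{z}}}\langle\boldsymbol{z}^{\kappa'\hbar-1}(\boldsymbol{x}),\boldsymbol{z}^{\kappa'\hbar-1}(\boldsymbol{x}')\rangle\langle\Delta^{\kappa'\hbar}(\boldsymbol{x}),\Delta^{\kappa'\hbar}(\boldsymbol{x}')\rangle$,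 $\Delta^{\kappa'\hbar}(\boldsymbol{x})=\sum_{\kappa=\kappa'}^{K}[\prod_{i=\kappa'\hbar}^{\kappa\hbar}(\hat{\mathbf{W}}^i)^\top\mathbf{D}^i(\boldsymbol{x})]{\mathbf{J}^{\kappa\hbar}}^\top$, $\mathbf{D}^i(\boldsymbol{x})=\text{diag}\{\dot\phi(\hat{\mathbf{W}}^i\boldsymbol{z}^{i-1}(\boldsymbol{x}))\}$, where products are ordered left to right with increasing $i$ and $\langle\mathbf{A},\mathbf{B}\rangle=\mathbf{A}^\top\mathbf{B}$, so that $\text{NTK}_{(d)}(\boldsymbol{x},\boldsymbol{x}')$ is an $n_o\times n_o$ matrix.
   Formalization: For ħ=1 the inputs are also assumed to satisfy ‖x‖²≤d and ‖x'‖²≤d, since the bound fails for large inputs (L=K=ħ=1, all widths 1, φ=sin, W=1/2, x=x'=4π gives 2π²>1/2); for ħ≥2 inputs are arbitrary. The output dimension n_o counts as a width in n_max. *)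

theory Defs
  imports "HOL-Analysis.Derivative" "Jordan_Normal_Form.Spectral_Radius"
begin

text \<open>Layer widths vary with the layer index, so matrices and vectors are those of
  \<^theory>\<open>Jordan_Normal_Form.Matrix\<close>, whose dimensions are values. The parameters below are
  the widths \<open>n\<close> (with \<open>n 0\<close> the input dimension), the output dimension \<open>n\<^sub>o\<close>, the
  weights \<open>W\<close>, the activation \<open>\<phi>\<close>, the separation constant \<open>h\<close> and the number \<open>K\<close> of
  shortcut connections.\<close>

text \<open>The singular values of \<open>A\<close> are the square roots of the eigenvalues of \<open>A\<^sup>T A\<close>. The maximum
  is over a nonempty finite set as soon as \<open>A\<close> has a column.\<close>

definition sigma_max :: "real mat \<Rightarrow> real" where
  "sigma_max A = Max (sqrt ` spectrum (transpose_mat A * A))"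

definition well_posed :: "real \<Rightarrow> (real \<Rightarrow> real) \<Rightarrow> bool" where
  "well_posed C \<phi> \<longleftrightarrow> (\<forall>t. \<phi> differentiable (at t)) \<and> (\<forall>t. \<bar>deriv \<phi> t\<bar> \<le> C)"

definition stable_pertinent :: "real \<Rightarrow> real mat \<Rightarrow> bool" where
  "stable_pertinent C A \<longleftrightarrow> (\<exists>\<epsilon>. 0 < \<epsilon> \<and> \<epsilon> < 1 \<and> C * sigma_max A \<le> \<epsilon>)"

definition scaled_weight :: "(nat \<Rightarrow> nat) \<Rightarrow> (nat \<Rightarrow> real mat) \<Rightarrow> nat \<Rightarrow> real mat" where
  "scaled_weight n W l = (1 / sqrt (real (n l))) \<cdot>\<^sub>m W l"

primrec layer ::
  "(nat \<Rightarrow> nat) \<Rightarrow> (nat \<Rightarrow> real mat) \<Rightarrow> (real \<Rightarrow> real) \<Rightarrow> real vec \<Rightarrow> nat \<Rightarrow> real vec" where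
  "layer n W \<phi> x 0 = x"
| "layer n W \<phi> x (Suc l) = map_vec \<phi> (scaled_weight n W (Suc l) *\<^sub>v layer n W \<phi> x l)"

definition total_width :: "(nat \<Rightarrow> nat) \<Rightarrow> nat \<Rightarrow> nat \<Rightarrow> nat" where
  "total_width n h K = (\<Sum>\<kappa>=0..K. n (\<kappa> * h))"

definition ones_mat :: "nat \<Rightarrow> nat \<Rightarrow> real mat" where
  "ones_mat r c = Matrix.mat r c (\<lambda>_. 1)"

text \<open>The depth-induced kernel is built from the layers, the all-ones shortcut matrices and the
  normalisation of this network; its output value does not itself occur in the kernel.\<close>

definition shortcut_network ::
  "(nat \<Rightarrow> nat) \<Rightarrow> nat \<Rightarrow> (nat \<Rightarrow> real mat) \<Rightarrow> (real \<Rightarrow> real) \<Rightarrow> nat \<Rightarrow> nat \<Rightarrow> real vec \<Rightarrow> real vec" where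
  "shortcut_network n n\<^sub>o W \<phi> h K x =
     (1 / sqrt (real (total_width n h K))) \<cdot>\<^sub>v
     foldr (+) (map (\<lambda>\<kappa>. ones_mat n\<^sub>o (n (\<kappa> * h)) *\<^sub>v layer n W \<phi> x (\<kappa> * h)) [0..<Suc K]) (0\<^sub>v n\<^sub>o)"

text \<open>\<open>D\<^sup>i(x)\<close>, meaningful for \<open>i \<ge> 1\<close>.\<close>

definition act_deriv ::
  "(nat \<Rightarrow> nat) \<Rightarrow> (nat \<Rightarrow> real mat) \<Rightarrow> (real \<Rightarrow> real) \<Rightarrow> real vec \<Rightarrow> nat \<Rightarrow> real mat" where
  "act_deriv n W \<phi> x i =
     mat_diag (n i) (\<lambda>j. deriv \<phi> (vec_index (scaled_weight n W i *\<^sub>v layer n W \<phi> x (i - 1)) j))"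

text \<open>The ordered product of \<open>(W\<^sup>i / sqrt (n i))\<^sup>T D\<^sup>i(x)\<close> for \<open>i = a, \<dots>, b\<close>, with the index
  increasing from left to right.\<close>

definition backward_prod ::
  "(nat \<Rightarrow> nat) \<Rightarrow> (nat \<Rightarrow> real mat) \<Rightarrow> (real \<Rightarrow> real) \<Rightarrow> real vec \<Rightarrow> nat \<Rightarrow> nat \<Rightarrow> real mat" where
  "backward_prod n W \<phi> x a b =
     foldr (*) (map (\<lambda>i. transpose_mat (scaled_weight n W i) * act_deriv n W \<phi> x i) [a..<Suc b])
       (1\<^sub>m (n b))"

definition Delta ::
  "(nat \<Rightarrow> nat) \<Rightarrow> nat \<Rightarrow> (nat \<Rightarrow> real mat) \<Rightarrow> (real \<Rightarrow> real) \<Rightarrow> nat \<Rightarrow> nat \<Rightarrow> real vec \<Rightarrow> nat \<Rightarrow> real mat" where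
  "Delta n n\<^sub>o W \<phi> h K x \<kappa>' =
     foldr (+)
       (map (\<lambda>\<kappa>. backward_prod n W \<phi> x (\<kappa>' * h) (\<kappa> * h) * transpose_mat (ones_mat n\<^sub>o (n (\<kappa> * h))))
         [\<kappa>'..<Suc K])
       (0\<^sub>m (n (\<kappa>' * h - 1)) n\<^sub>o)"

definition NTK_d_layer ::
  "(nat \<Rightarrow> nat) \<Rightarrow> nat \<Rightarrow> (nat \<Rightarrow> real mat) \<Rightarrow> (real \<Rightarrow> real) \<Rightarrow> nat \<Rightarrow> nat
    \<Rightarrow> real vec \<Rightarrow> real vec \<Rightarrow> nat \<Rightarrow> real mat" where
  "NTK_d_layer n n\<^sub>o W \<phi> h K x x' \<kappa>' =
     (1 / real (total_width n h K)
       * scalar_prod (layer n W \<phi> x (\<kappa>' * h - 1)) (layer n W \<phi> x' (\<kappa>' * h - 1)))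
     \<cdot>\<^sub>m (transpose_mat (Delta n n\<^sub>o W \<phi> h K x \<kappa>') * Delta n n\<^sub>o W \<phi> h K x' \<kappa>')"

definition NTK_d ::
  "(nat \<Rightarrow> nat) \<Rightarrow> nat \<Rightarrow> (nat \<Rightarrow> real mat) \<Rightarrow> (real \<Rightarrow> real) \<Rightarrow> nat \<Rightarrow> nat
    \<Rightarrow> real vec \<Rightarrow> real vec \<Rightarrow> real mat" where
  "NTK_d n n\<^sub>o W \<phi> h K x x' =
     foldr (+) (map (NTK_d_layer n n\<^sub>o W \<phi> h K x x') [1..<Suc K]) (0\<^sub>m n\<^sub>o n\<^sub>o)"

text \<open>The output dimension counts as a width: the bound on the kernel grows with \<open>n\<^sub>o\<close>.\<close>

definition n_max :: "(nat \<Rightarrow> nat) \<Rightarrow> nat \<Rightarrow> nat \<Rightarrow> nat" where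
  "n_max n n\<^sub>o L = Max (insert n\<^sub>o (n ` {0..L}))"

end

theory Submission
  imports Defs
begin

text \<open>Each backward factor \<open>(W\<^sup>i / sqrt (n i))\<^sup>T D\<^sup>i\<close> has operator norm at most
  \<open>C \<sigma>\<^sub>m\<^sub>a\<^sub>x(W\<^sup>i) / sqrt (n i) \<le> 1 / sqrt (n i)\<close>. In a product ending at layer \<open>\<kappa>h\<close>, bounding all
  factors but the last by 1 leaves \<open>1 / sqrt (n (\<kappa>h))\<close>, which cancels the width in the norm
  \<open>sqrt (n (\<kappa>h) n\<^sub>o)\<close> of the all-ones shortcut. Hence \<open>\<Delta>\<close> at level \<open>\<kappa>'\<close> has norm at most
  \<open>(K + 1 - \<kappa>') sqrt n\<^sub>o\<close>. With \<open>\<bar>\<langle>z, z'\<rangle>\<bar> \<le> n\<^sub>m\<^sub>a\<^sub>x\<close>, summing squares gives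
  \<open>K (K + 1) (2 K + 1) / 6\<close>, and the factor \<open>K + 1\<close> is absorbed by the normalisation, a sum of
  \<open>K + 1\<close> widths.\<close>

section \<open>Euclidean norm and operator bounds\<close>

definition vnorm :: "real vec \<Rightarrow> real" where
  "vnorm v = sqrt (scalar_prod v v)"

text \<open>An upper bound for the operator norm instead of the norm itself, so that bounds combine
  under sums and products without suprema. Without columns the inequality holds for every
  \<open>c\<close>, so nonnegativity is asked for separately.\<close>

definition op_bound :: "real mat \<Rightarrow> real \<Rightarrow> bool" where
  "op_bound A c \<longleftrightarrow> 0 \<le> c \<and> (\<forall>v \<in> carrier_vec (dim_col A). vnorm (A *\<^sub>v v) \<le> c * vnorm v)"

lemma scalar_prod_self_nonneg: "0 \<le> scalar_prod v (v :: real vec)"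
  by (auto simp: scalar_prod_def intro!: sum_nonneg)

lemma vnorm_nonneg [simp]: "0 \<le> vnorm v"
  by (simp add: vnorm_def scalar_prod_self_nonneg)

lemma vnorm_square: "vnorm v ^ 2 = scalar_prod v v"
  by (simp add: vnorm_def scalar_prod_self_nonneg)

lemma vnorm_eq_L2_set:
  assumes "dim_vec v = n"
  shows "vnorm v = L2_set (vec_index v) {0..<n}"
  using assms by (simp add: vnorm_def scalar_prod_def L2_set_def power2_eq_square)

lemma vnorm_eq_0_iff:
  assumes "v \<in> carrier_vec n"
  shows "vnorm v = 0 \<longleftrightarrow> v = 0\<^sub>v n"
  using assms by (auto simp: vnorm_eq_L2_set[of v n] L2_set_eq_0_iff)

lemma vnorm_smult: "vnorm (c \<cdot>\<^sub>v v) = \<bar>c\<bar> * vnorm v"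
  by (simp add: vnorm_def real_sqrt_mult flip: mult.assoc)

lemma vnorm_triangle:
  assumes "v \<in> carrier_vec n" "w \<in> carrier_vec n"
  shows "vnorm (v + w) \<le> vnorm v + vnorm w"
proof -
  have "vnorm (v + w) = L2_set (\<lambda>i. vec_index v i + vec_index w i) {0..<n}"
    using assms by (simp add: vnorm_eq_L2_set[of _ n] cong: L2_set_cong_simp)
  also have "\<dots> \<le> vnorm v + vnorm w"
    using assms by (simp add: vnorm_eq_L2_set[of _ n] L2_set_triangle_ineq)
  finally show ?thesis .
qed

lemma scalar_prod_Cauchy_Schwarz:
  assumes "v \<in> carrier_vec n" "w \<in> carrier_vec n"
  shows "\<bar>scalar_prod v w\<bar> \<le> vnorm v * vnorm w"
proof -
  have "\<bar>scalar_prod v w\<bar> \<le> (\<Sum>i\<in>{0..<n}. \<bar>vec_index v i\<bar> * \<bar>vec_index w i\<bar>)"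
    using assms by (auto simp: scalar_prod_def abs_mult intro: order_trans[OF sum_abs])
  also have "\<dots> \<le> vnorm v * vnorm w"
    using assms L2_set_mult_ineq by (simp add: vnorm_eq_L2_set[of _ n])
  finally show ?thesis .
qed

section \<open>The largest singular value as the least operator bound\<close>

lemma scalar_prod_transpose_mult:
  fixes A :: "real mat"
  assumes "A \<in> carrier_mat m n" "v \<in> carrier_vec n" "w \<in> carrier_vec n"
  shows "scalar_prod ((transpose_mat A * A) *\<^sub>v v) w = scalar_prod (A *\<^sub>v v) (A *\<^sub>v w)"
  using assms transpose_vec_mult_scalar[of A m n w "A *\<^sub>v v"]
    assoc_mult_mat_vec[of "transpose_mat A" n m A n v] by simp

text \<open>A continuous function attains its maximum on the compact unit sphere. Since
  \<open>n\<close> is a value and not a type, the sphere is realised inside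
  \<open>nat \<Rightarrow> real\<close>, as functions that vanish from index \<open>n\<close>
  on.\<close>

lemma vnorm_attains_max:
  assumes A: "A \<in> carrier_mat m n" and n: "0 < n"
  obtains v where "v \<in> carrier_vec n" "vnorm v = 1"
    "\<And>w. w \<in> carrier_vec n \<Longrightarrow> vnorm (A *\<^sub>v w) \<le> vnorm (A *\<^sub>v v) * vnorm w"
proof -
  \<comment> \<open>The cube of side \<open>{-1..1}\<close> in the first \<open>n\<close>
    coordinates. Pinning all other coordinates to 0 makes every factor compact, so Tychonoff's
    theorem applies to the infinite product.\<close>
  define B :: "(nat \<Rightarrow> real) set" where "B = Pi\<^sub>E UNIV (\<lambda>i. if i < n then {-1..1} else {0})"
  define S where "S = B \<inter> {f. (\<Sum>i=0..<n. f i * f i) = 1}"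
  define g where "g f = sqrt (\<Sum>i=0..<m. (\<Sum>j=0..<n. A $$ (i, j) * f j) ^ 2)" for f :: "nat \<Rightarrow> real"
  have "compactin (product_topology (\<lambda>_. euclidean) UNIV) B"
    unfolding B_def by (subst compactin_PiE) auto
  then have "compact B"
    by (simp add: euclidean_product_topology)
  moreover have "closed {f :: nat \<Rightarrow> real. (\<Sum>i=0..<n. f i * f i) = 1}"
    by (intro closed_Collect_eq continuous_intros continuous_on_product_coordinates)
  ultimately have "compact S"
    by (simp add: S_def compact_Int_closed)
  have sum_single: "(\<Sum>i=0..<n. (if i = 0 then 1 else 0) * (if i = 0 then 1 else 0)) = (1::real)"
  proof -
    have "(\<Sum>i=0..<n. (if i = 0 then 1 else 0) * (if i = 0 then 1 else 0)) = (\<Sum>i=0..<n. if i = 0 then 1 else (0::real))"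
      by (rule sum.cong) auto
    also have "\<dots> = 1"
      using n by simp
    finally show ?thesis .
  qed
  \<comment> \<open>The first unit vector is on the sphere; this is where \<open>0 < n\<close>
    enters.\<close>
  have "(\<lambda>i. if i = 0 then 1 else 0) \<in> S"
    using n sum_single by (auto simp: S_def B_def)
  then have "S \<noteq> {}"
    by blast
  have "continuous_on S g"
    unfolding g_def
    by (intro continuous_intros continuous_on_subset[OF continuous_on_product_coordinates]) auto
  obtain f where f: "f \<in> S" "\<And>f'. f' \<in> S \<Longrightarrow> g f' \<le> g f"
    using continuous_attains_sup[OF \<open>compact S\<close> \<open>S \<noteq> {}\<close> \<open>continuous_on S g\<close>] by blast
  have g: "vnorm (A *\<^sub>v w) = g (vec_index w)" if "w \<in> carrier_vec n" for w
    using A that by (simp add: vnorm_eq_L2_set[of _ m] L2_set_def g_def scalar_prod_def)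
  have g_cong: "g f = g f'" if "\<And>i. i < n \<Longrightarrow> f i = f' i" for f f'
    using that by (simp add: g_def)
  let ?v = "Matrix.vec n f"
  have gv: "vnorm (A *\<^sub>v ?v) = g f"
    by (subst g) (auto intro: g_cong)
  have unit: "vnorm (A *\<^sub>v u) \<le> g f" if u: "u \<in> carrier_vec n" "vnorm u = 1" for u
  proof -
    define f' where "f' i = (if i < n then vec_index u i else 0)" for i
    have *: "(\<Sum>i=0..<n. f' i * f' i) = 1"
      using u by (simp add: f'_def vnorm_def scalar_prod_def)
    \<comment> \<open>Coordinates of a unit vector lie in \<open>{-1..1}\<close>, so intersecting
      with the cube cuts nothing off the sphere.\<close>
    have "\<bar>f' i\<bar> \<le> 1" for i
    proof (cases "i < n")
      case True
      then have "f' i * f' i \<le> (\<Sum>i=0..<n. f' i * f' i)"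
        by (intro member_le_sum) auto
      then show ?thesis
        using * by (simp add: abs_square_le_1 flip: power2_eq_square)
    qed (simp add: f'_def)
    then have "f' i \<in> (if i < n then {-1..1} else {0})" for i
      by (auto simp: f'_def abs_le_iff minus_le_iff) (metis f'_def)+
    then have "f' \<in> S"
      using * by (auto simp: S_def B_def)
    then have "g f' \<le> g f"
      by (rule f)
    moreover have "g f' = g (vec_index u)"
      by (rule g_cong) (simp add: f'_def)
    ultimately show ?thesis
      using g u by simp
  qed
  show thesis
  proof
    show "?v \<in> carrier_vec n"
      by simp
    show "vnorm ?v = 1"
      using f(1) by (simp add: S_def vnorm_def scalar_prod_def)
    fix w :: "real vec" assume w: "w \<in> carrier_vec n"
    show "vnorm (A *\<^sub>v w) \<le> vnorm (A *\<^sub>v ?v) * vnorm w"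
    \<comment> \<open>Homogeneity reduces to unit vectors; the zero vector cannot be
      normalised.\<close>
    proof (cases "vnorm w = 0")
      case True
      then have "w = 0\<^sub>v n"
        using vnorm_eq_0_iff w by blast
      then have "A *\<^sub>v w = 0\<^sub>v m"
        using A by auto
      then show ?thesis
        using vnorm_eq_0_iff[of "0\<^sub>v m" m] by simp
    next
      case False
      have "vnorm (A *\<^sub>v ((1 / vnorm w) \<cdot>\<^sub>v w)) \<le> g f"
        using w False by (intro unit) (auto simp: vnorm_smult)
      then have "vnorm (A *\<^sub>v w) / vnorm w \<le> g f"
        using mult_mat_vec[OF A w] by (simp add: vnorm_smult)
      moreover have "0 < vnorm w"
        using False vnorm_nonneg[of w] by linarith
      ultimately show ?thesis
        using gv by (simp add: divide_le_eq)
    qed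
  qed
qed

text \<open>Near \<open>t = 0\<close> a nonzero linear term outgrows any quadratic one. This serves
  as the first-order condition at a maximum.\<close>

lemma linear_le_quadratic_imp_0:
  fixes c q :: real
  assumes "\<And>t. t * c \<le> t ^ 2 * q"
  shows "c = 0"
proof (rule ccontr)
  assume "c \<noteq> 0"
  \<comment> \<open>Any positive \<open>r\<close> above \<open>q\<close> works:
    \<open>t = c / r\<close> yields \<open>r * c ^ 2 \<le> q * c ^ 2\<close>.\<close>
  define r where "r = \<bar>q\<bar> + 1"
  have r: "0 < r" "q < r"
    by (auto simp: r_def)
  have "c / r * c \<le> (c / r) ^ 2 * q"
    by (rule assms)
  then have "r * c ^ 2 \<le> q * c ^ 2"
    using r by (simp add: power2_eq_square field_simps)
  then show False
    using r \<open>c \<noteq> 0\<close> by simp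
qed

text \<open>A unit vector maximising \<open>\<bar>A v\<bar>\<close> is an eigenvector of \<open>A\<^sup>T A\<close>: the first variation of
  the Rayleigh quotient vanishes.\<close>

lemma op_bound_by_eigenvalue:
  assumes A: "A \<in> carrier_mat m n" and n: "0 < n"
  obtains l where "l \<in> spectrum (transpose_mat A * A)" "op_bound A (sqrt l)"
proof -
  obtain v where v: "v \<in> carrier_vec n" "vnorm v = 1"
    and max: "\<And>w. w \<in> carrier_vec n \<Longrightarrow> vnorm (A *\<^sub>v w) \<le> vnorm (A *\<^sub>v v) * vnorm w"
    using vnorm_attains_max[OF A n] by blast
  define l where "l = vnorm (A *\<^sub>v v) ^ 2"
  let ?S = "transpose_mat A * A"
  \<comment> \<open>The eigenvalue equation in weak form, tested against every direction
    \<open>w\<close>.\<close>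
  have orth: "scalar_prod (?S *\<^sub>v v) w = l * scalar_prod v w" if w: "w \<in> carrier_vec n" for w
  proof -
    have quad: "vnorm (a + t \<cdot>\<^sub>v b) ^ 2 = vnorm a ^ 2 + 2 * t * scalar_prod a b + t ^ 2 * vnorm b ^ 2"
      if "a \<in> carrier_vec k" "b \<in> carrier_vec k" for a b t k
      using that comm_scalar_prod[OF that]
      by (simp add: vnorm_square scalar_prod_add_distrib[of _ k] add_scalar_prod_distrib[of _ k]
          power2_eq_square[of t] algebra_simps)
    \<comment> \<open>Maximality at \<open>v + t w\<close>, squared and expanded. The terms free of
      \<open>t\<close> cancel because \<open>vnorm v = 1\<close> and \<open>l\<close> is the squared
      maximum.\<close>
    have "t * (2 * (scalar_prod (A *\<^sub>v v) (A *\<^sub>v w) - l * scalar_prod v w))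
        \<le> t ^ 2 * (l * vnorm w ^ 2 - vnorm (A *\<^sub>v w) ^ 2)" for t
    proof -
      have "A *\<^sub>v (v + t \<cdot>\<^sub>v w) = A *\<^sub>v v + t \<cdot>\<^sub>v (A *\<^sub>v w)"
        using A v w by (simp add: mult_add_distrib_mat_vec[of A m n] mult_mat_vec[of A m n])
      moreover have "vnorm (A *\<^sub>v (v + t \<cdot>\<^sub>v w)) ^ 2 \<le> (vnorm (A *\<^sub>v v) * vnorm (v + t \<cdot>\<^sub>v w)) ^ 2"
        using v w by (intro power_mono max) auto
      ultimately have "vnorm (A *\<^sub>v v + t \<cdot>\<^sub>v (A *\<^sub>v w)) ^ 2 \<le> l * vnorm (v + t \<cdot>\<^sub>v w) ^ 2"
        by (simp add: l_def power_mult_distrib)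
      then show ?thesis
        using A v w
        by (simp add: quad[of v n w] quad[of "A *\<^sub>v v" m "A *\<^sub>v w"]) (simp add: l_def algebra_simps)
    qed
    then have "2 * (scalar_prod (A *\<^sub>v v) (A *\<^sub>v w) - l * scalar_prod v w) = 0"
      by (rule linear_le_quadratic_imp_0)
    then show ?thesis
      using scalar_prod_transpose_mult[OF A v(1) w] by simp
  qed
  \<comment> \<open>The residual of the eigenvalue equation; testing the weak form against
    \<open>u\<close> itself shows that it vanishes.\<close>
  define u where "u = ?S *\<^sub>v v - l \<cdot>\<^sub>v v"
  have S: "?S \<in> carrier_mat n n"
    using A by simp
  have Sv: "?S *\<^sub>v v \<in> carrier_vec n"
    using S v(1) by (rule mult_mat_vec_carrier)
  have u: "u \<in> carrier_vec n"
    using Sv v by (simp add: u_def)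
  have "scalar_prod u u = scalar_prod (?S *\<^sub>v v) u - l * scalar_prod v u"
    using Sv v u minus_scalar_prod_distrib[of "?S *\<^sub>v v" n "l \<cdot>\<^sub>v v" u] by (simp add: u_def)
  then have "vnorm u = 0"
    using orth[OF u] by (simp add: vnorm_def)
  then have "u = 0\<^sub>v n"
    using vnorm_eq_0_iff u by blast
  have "?S *\<^sub>v v = l \<cdot>\<^sub>v v"
  proof (rule eq_vecI)
    fix i assume "i < dim_vec (l \<cdot>\<^sub>v v)"
    then have "i < n"
      using v by simp
    then have "vec_index u i = 0"
      using \<open>u = 0\<^sub>v n\<close> by simp
    then show "vec_index (?S *\<^sub>v v) i = vec_index (l \<cdot>\<^sub>v v) i"
      using \<open>i < n\<close> v Sv by (simp add: u_def)
  qed (use A v in simp)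
  moreover have "v \<noteq> 0\<^sub>v n"
    using v vnorm_eq_0_iff[of v n] by auto
  ultimately have "l \<in> spectrum ?S"
    using A v unfolding spectrum_def eigenvalue_def eigenvector_def by auto
  moreover have "op_bound A (sqrt l)"
    using A max by (simp add: op_bound_def l_def)
  ultimately show thesis
    by (rule that)
qed

lemma op_bound_mono: "op_bound A c \<Longrightarrow> c \<le> c' \<Longrightarrow> op_bound A c'"
  unfolding op_bound_def by (meson mult_right_mono order_trans vnorm_nonneg)

lemma op_boundD: "op_bound A c \<Longrightarrow> v \<in> carrier_vec (dim_col A) \<Longrightarrow> vnorm (A *\<^sub>v v) \<le> c * vnorm v"
  by (simp add: op_bound_def)

lemma op_bound_nonneg: "op_bound A c \<Longrightarrow> 0 \<le> c"
  by (simp add: op_bound_def)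

lemma finite_spectrum_gram:
  fixes A :: "real mat"
  assumes "A \<in> carrier_mat m n"
  shows "finite (spectrum (transpose_mat A * A))"
  using assms by (intro card_finite_spectrum(1)[of _ n]) simp

text \<open>The eigenvalue obtained by maximisation is one of the finitely many over which
  \<open>sigma_max\<close> takes the maximum.\<close>

lemma op_bound_sigma_max:
  assumes A: "A \<in> carrier_mat m n" and n: "0 < n"
  shows "op_bound A (sigma_max A)"
proof -
  obtain l where l: "l \<in> spectrum (transpose_mat A * A)" "op_bound A (sqrt l)"
    using op_bound_by_eigenvalue[OF A n] by blast
  have "sqrt l \<le> sigma_max A"
    unfolding sigma_max_def using l finite_spectrum_gram[OF A] by (intro Max_ge) auto
  with l(2) show ?thesis
    by (rule op_bound_mono)
qed

text \<open>An eigenvector \<open>v\<close> of the Gram matrix for \<open>l\<close> is stretched by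
  \<open>A\<close> by exactly \<open>sqrt l\<close>, so no operator bound lies below a singular
  value.\<close>

lemma sigma_max_le:
  assumes A: "A \<in> carrier_mat m n" and n: "0 < n" and c: "op_bound A c"
  shows "sigma_max A \<le> c"
proof -
  let ?S = "transpose_mat A * A"
  have "sqrt l \<le> c" if l: "l \<in> spectrum ?S" for l
  proof -
    obtain v where v: "v \<in> carrier_vec n" "v \<noteq> 0\<^sub>v n" "?S *\<^sub>v v = l \<cdot>\<^sub>v v"
      using l A by (auto simp: spectrum_def eigenvalue_def eigenvector_def simp del: assoc_mult_mat_vec)
    have "vnorm (A *\<^sub>v v) ^ 2 = l * vnorm v ^ 2"
      using scalar_prod_transpose_mult[OF A v(1) v(1)] v by (simp add: vnorm_square)
    moreover have "vnorm (A *\<^sub>v v) ^ 2 \<le> (c * vnorm v) ^ 2"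
      using c v A by (intro power_mono op_boundD) auto
    ultimately have "l * vnorm v ^ 2 \<le> c ^ 2 * vnorm v ^ 2"
      by (simp add: power_mult_distrib)
    moreover have "0 < vnorm v ^ 2"
      using vnorm_eq_0_iff v by auto
    ultimately have "l \<le> c ^ 2"
      by simp
    then show ?thesis
      using op_bound_nonneg[OF c] by (simp add: real_le_lsqrt)
  qed
  \<comment> \<open>\<open>Max\<close> says nothing about an empty set, so a real eigenvalue must be
    exhibited.\<close>
  moreover have "spectrum ?S \<noteq> {}"
    using op_bound_by_eigenvalue[OF A n] by blast
  ultimately show ?thesis
    unfolding sigma_max_def using finite_spectrum_gram[OF A] by (intro Max.boundedI) auto
qed

section \<open>Operator bounds for sums, products, transposes and special matrices\<close>

lemma op_bound_add:
  assumes "A \<in> carrier_mat m n" "B \<in> carrier_mat m n" "op_bound A a" "op_bound B b"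
  shows "op_bound (A + B) (a + b)"
proof -
  have "vnorm ((A + B) *\<^sub>v v) \<le> (a + b) * vnorm v" if v: "v \<in> carrier_vec n" for v
  proof -
    have "vnorm ((A + B) *\<^sub>v v) \<le> vnorm (A *\<^sub>v v) + vnorm (B *\<^sub>v v)"
      using assms v by (simp add: add_mult_distrib_mat_vec[of A m n] vnorm_triangle[of _ m])
    also have "\<dots> \<le> a * vnorm v + b * vnorm v"
      using assms v by (intro add_mono op_boundD) auto
    finally show ?thesis
      by (simp add: algebra_simps)
  qed
  then show ?thesis
    using assms by (simp add: op_bound_def)
qed

lemma op_bound_mult:
  assumes "A \<in> carrier_mat m n" "B \<in> carrier_mat n k" "op_bound A a" "op_bound B b"
  shows "op_bound (A * B) (a * b)"
proof -
  have "vnorm ((A * B) *\<^sub>v v) \<le> a * b * vnorm v" if v: "v \<in> carrier_vec k" for v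
  proof -
    have "vnorm ((A * B) *\<^sub>v v) \<le> a * vnorm (B *\<^sub>v v)"
      using assms v by (simp add: assoc_mult_mat_vec[of A m n B k] op_boundD)
    also have "\<dots> \<le> a * (b * vnorm v)"
      using assms v by (intro mult_left_mono op_boundD) (auto simp: op_bound_nonneg)
    finally show ?thesis
      by (simp add: mult.assoc)
  qed
  then show ?thesis
    using assms by (simp add: op_bound_def)
qed

lemma op_bound_smult:
  assumes "op_bound A a"
  shows "op_bound (c \<cdot>\<^sub>m A) (\<bar>c\<bar> * a)"
proof -
  have "(c \<cdot>\<^sub>m A) *\<^sub>v v = c \<cdot>\<^sub>v (A *\<^sub>v v)" if "v \<in> carrier_vec (dim_col A)" for v
    using that by (intro eq_vecI) auto
  then show ?thesis
    using assms by (simp add: op_bound_def vnorm_smult mult.assoc mult_left_mono)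
qed

text \<open>Write \<open>u\<close> for the transpose applied to \<open>v\<close>. By adjointness and
  Cauchy-Schwarz the square of \<open>vnorm u\<close> is at most
  \<open>vnorm v * (a * vnorm u)\<close>, and one factor \<open>vnorm u\<close> cancels.\<close>

lemma op_bound_transpose:
  assumes A: "A \<in> carrier_mat m n" and a: "op_bound A a"
  shows "op_bound (transpose_mat A) a"
proof -
  have "vnorm (transpose_mat A *\<^sub>v v) \<le> a * vnorm v" if v: "v \<in> carrier_vec m" for v
  proof (cases "vnorm (transpose_mat A *\<^sub>v v) = 0")
    case True
    then show ?thesis
      using op_bound_nonneg[OF a] by simp
  next
    case False
    let ?u = "transpose_mat A *\<^sub>v v"
    have u: "?u \<in> carrier_vec n"
      using A by (auto intro: carrier_vecI)
    have "vnorm ?u * vnorm ?u = scalar_prod v (A *\<^sub>v ?u)"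
      using transpose_vec_mult_scalar[OF A u v] by (simp add: vnorm_square flip: power2_eq_square)
    also have "\<dots> \<le> vnorm v * vnorm (A *\<^sub>v ?u)"
      using scalar_prod_Cauchy_Schwarz[of v m "A *\<^sub>v ?u"] A v by (auto intro: carrier_vecI)
    also have "\<dots> \<le> vnorm v * (a * vnorm ?u)"
      using A u a by (intro mult_left_mono op_boundD) auto
    finally have "vnorm ?u * vnorm ?u \<le> (a * vnorm v) * vnorm ?u"
      by (simp add: mult_ac)
    moreover have "0 < vnorm ?u"
      using False vnorm_nonneg[of ?u] by linarith
    ultimately show ?thesis
      by simp
  qed
  then show ?thesis
    using A op_bound_nonneg[OF a] by (simp add: op_bound_def)
qed

lemma op_bound_zero: "op_bound (0\<^sub>m m n) 0"
proof -
  have "0\<^sub>m m n *\<^sub>v v = 0\<^sub>v m" if "v \<in> carrier_vec n" for v :: "real vec"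
    using that by (intro eq_vecI) auto
  then show ?thesis
    using vnorm_eq_0_iff[of "0\<^sub>v m" m] by (simp add: op_bound_def)
qed

lemma op_bound_mat_diag:
  assumes c: "0 \<le> c" and f: "\<And>i. \<bar>f i\<bar> \<le> c"
  shows "op_bound (mat_diag n f) c"
proof -
  have "vnorm (mat_diag n f *\<^sub>v v) \<le> c * vnorm v" if v: "v \<in> carrier_vec n" for v
  proof -
    have "vec_index (mat_diag n f *\<^sub>v v) i = f i * vec_index v i" if "i < n" for i
    proof -
      have "vec_index (mat_diag n f *\<^sub>v v) i = (\<Sum>j=0..<n. (if i = j then f j else 0) * vec_index v j)"
        using that v by (simp add: mat_diag_def scalar_prod_def)
      also have "\<dots> = (\<Sum>j=0..<n. if i = j then f j * vec_index v j else 0)"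
        by (rule sum.cong) auto
      finally show ?thesis
        using that by simp
    qed
    then have "vnorm (mat_diag n f *\<^sub>v v) = L2_set (\<lambda>i. f i * vec_index v i) {0..<n}"
      by (simp add: vnorm_eq_L2_set[of _ n] mat_diag_def cong: L2_set_cong_simp)
    also have "\<dots> = L2_set (\<lambda>i. \<bar>f i * vec_index v i\<bar>) {0..<n}"
      by (simp add: L2_set_def)
    also have "\<dots> \<le> L2_set (\<lambda>i. c * \<bar>vec_index v i\<bar>) {0..<n}"
      using f by (intro L2_set_mono) (auto simp: abs_mult intro: mult_right_mono)
    also have "\<dots> = c * vnorm v"
      using c v by (simp add: vnorm_eq_L2_set[of _ n] L2_set_def power_mult_distrib real_sqrt_mult
          flip: sum_distrib_left)
    finally show ?thesis .
  qed
  then show ?thesis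
    using c by (simp add: op_bound_def mat_diag_def)
qed

text \<open>All \<open>r\<close> entries of the image equal the coordinate sum of \<open>v\<close>,
  which Cauchy-Schwarz against the constant vector 1 bounds by
  \<open>sqrt c * vnorm v\<close>.\<close>

lemma op_bound_ones_mat: "op_bound (ones_mat r c) (sqrt (real r) * sqrt (real c))"
proof -
  have "vnorm (ones_mat r c *\<^sub>v v) \<le> sqrt (real r) * sqrt (real c) * vnorm v"
    if v: "v \<in> carrier_vec c" for v
  proof -
    let ?s = "\<Sum>i=0..<c. vec_index v i"
    have "vnorm (ones_mat r c *\<^sub>v v) = L2_set (\<lambda>_. ?s) {0..<r}"
      using v by (simp add: vnorm_eq_L2_set[of _ r] ones_mat_def scalar_prod_def cong: L2_set_cong_simp)
    also have "\<dots> = sqrt (real r) * \<bar>?s\<bar>"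
      by (simp add: L2_set_constant)
    also have "\<bar>?s\<bar> \<le> (\<Sum>i=0..<c. \<bar>1\<bar> * \<bar>vec_index v i\<bar>)"
      by simp
    also have "\<dots> \<le> sqrt (real c) * vnorm v"
      using L2_set_mult_ineq[of "\<lambda>_. 1" "vec_index v" "{0..<c}"] v
      by (simp add: vnorm_eq_L2_set[of _ c] L2_set_constant)
    finally show ?thesis
      by (simp add: mult_left_mono mult.assoc)
  qed
  then show ?thesis
    by (simp add: op_bound_def ones_mat_def)
qed

text \<open>Dimensions and bound go through one induction, since adding bounds requires matching
  dimensions.\<close>

lemma op_bound_foldr_add:
  assumes "\<And>i. i \<in> set xs \<Longrightarrow> F i \<in> carrier_mat r c" "\<And>i. i \<in> set xs \<Longrightarrow> op_bound (F i) (b i)"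
  shows "foldr (+) (map F xs) (0\<^sub>m r c) \<in> carrier_mat r c \<and>
    op_bound (foldr (+) (map F xs) (0\<^sub>m r c)) (sum_list (map b xs))"
  using assms
proof (induction xs)
  case Nil
  then show ?case
    by (simp add: op_bound_zero)
next
  case (Cons i xs)
  then show ?case
    by (auto intro: op_bound_add)
qed

section \<open>Bounds for layers, backward products and \<open>Delta\<close>\<close>

lemma vnorm_le_sqrt_dim:
  assumes "dim_vec v = n" "\<And>i. i < n \<Longrightarrow> \<bar>vec_index v i\<bar> \<le> 1"
  shows "vnorm v \<le> sqrt (real n)"
proof -
  have "vnorm v = L2_set (\<lambda>i. \<bar>vec_index v i\<bar>) {0..<n}"
    using assms by (simp add: vnorm_eq_L2_set[of _ n] L2_set_def)
  also have "\<dots> \<le> L2_set (\<lambda>_. 1) {0..<n}"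
    using assms by (intro L2_set_mono) auto
  finally show ?thesis
    by (simp add: L2_set_constant)
qed

text \<open>From layer 1 on every coordinate is a value of \<open>\<phi>\<close>. Layer 0 is the raw
  input, which \<open>\<phi>\<close> does not control.\<close>

lemma layer_bound:
  assumes W: "\<And>l. l \<in> {1..L} \<Longrightarrow> W l \<in> carrier_mat (n l) (n (l - 1))"
    and \<phi>: "\<And>t. \<bar>\<phi> t\<bar> \<le> 1" and l: "l \<in> {1..L}"
  shows "layer n W \<phi> x l \<in> carrier_vec (n l)" "vnorm (layer n W \<phi> x l) \<le> sqrt (real (n l))"
proof -
  obtain k where k: "l = Suc k"
    using l by (cases l) auto
  have dim: "dim_row (scaled_weight n W (Suc k)) = n (Suc k)"
    using W[OF l] k by (simp add: scaled_weight_def)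
  show "layer n W \<phi> x l \<in> carrier_vec (n l)"
    using dim k by (intro carrier_vecI) simp
  show "vnorm (layer n W \<phi> x l) \<le> sqrt (real (n l))"
    using dim k \<phi> by (intro vnorm_le_sqrt_dim) auto
qed

text \<open>The diagonal factor contributes \<open>C\<close> and the scaled weight contributes
  \<open>sigma_max (W l) / sqrt (n l)\<close>; stable-pertinence bounds the product
  \<open>C * sigma_max (W l)\<close> by 1.\<close>

lemma backward_factor:
  fixes x :: "real vec"
  assumes W: "W l \<in> carrier_mat (n l) (n (l - 1))" and n: "1 \<le> n l" "1 \<le> n (l - 1)"
    and \<phi>: "well_posed C \<phi>" and stab: "stable_pertinent C (W l)"
  defines "F \<equiv> transpose_mat (scaled_weight n W l) * act_deriv n W \<phi> x l"
  shows "F \<in> carrier_mat (n (l - 1)) (n l)" "op_bound F (1 / sqrt (real (n l)))"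
proof -
  let ?s = "sigma_max (W l)"
  have dims: "transpose_mat (scaled_weight n W l) \<in> carrier_mat (n (l - 1)) (n l)"
    "act_deriv n W \<phi> x l \<in> carrier_mat (n l) (n l)"
    using W by (auto simp: scaled_weight_def act_deriv_def)
  then show "F \<in> carrier_mat (n (l - 1)) (n l)"
    by (simp add: F_def)
  have "\<bar>deriv \<phi> t\<bar> \<le> C" for t
    using \<phi> by (simp add: well_posed_def)
  moreover from this[of 0] have "0 \<le> C"
    by linarith
  ultimately have D: "op_bound (act_deriv n W \<phi> x l) C"
    by (simp add: act_deriv_def op_bound_mat_diag)
  have "op_bound (scaled_weight n W l) (\<bar>1 / sqrt (real (n l))\<bar> * ?s)"
    unfolding scaled_weight_def using n by (intro op_bound_smult op_bound_sigma_max[OF W]) simp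
  then have "op_bound (transpose_mat (scaled_weight n W l)) (?s / sqrt (real (n l)))"
    using W by (intro op_bound_transpose[of _ "n l" "n (l - 1)"]) (auto simp: scaled_weight_def)
  then have "op_bound F (?s / sqrt (real (n l)) * C)"
    unfolding F_def using D by (rule op_bound_mult[OF dims])
  moreover have "C * ?s \<le> 1"
    using stab by (force simp: stable_pertinent_def)
  ultimately show "op_bound F (1 / sqrt (real (n l)))"
    by (elim op_bound_mono) (simp add: mult.commute divide_right_mono)
qed

text \<open>Induction downwards on the left end \<open>a\<close>: the factor at \<open>b\<close>
  supplies the bound, and each factor put in front costs at most 1 because widths are at least
  1.\<close>

lemma backward_prod_bound:
  assumes n: "\<And>l. l \<le> L \<Longrightarrow> 1 \<le> n l"
    and W: "\<And>l. l \<in> {1..L} \<Longrightarrow> W l \<in> carrier_mat (n l) (n (l - 1))"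
    and \<phi>: "well_posed C \<phi>" and stab: "\<And>l. l \<in> {1..L} \<Longrightarrow> stable_pertinent C (W l)"
    and ab: "a \<le> b" "1 \<le> a" "b \<le> L"
  shows "backward_prod n W \<phi> x a b \<in> carrier_mat (n (a - 1)) (n b) \<and>
    op_bound (backward_prod n W \<phi> x a b) (1 / sqrt (real (n b)))"
proof -
  have factor: "transpose_mat (scaled_weight n W l) * act_deriv n W \<phi> x l \<in> carrier_mat (n (l - 1)) (n l)"
    "op_bound (transpose_mat (scaled_weight n W l) * act_deriv n W \<phi> x l) (1 / sqrt (real (n l)))"
    if "1 \<le> l" "l \<le> L" for l
    using backward_factor[of W l n C \<phi> x] n[of l] n[of "l - 1"] W[of l] \<phi> stab[of l] that by simp_all
  show ?thesis
    using ab
  proof (induction a rule: inc_induct)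
    case base
    let ?F = "transpose_mat (scaled_weight n W b) * act_deriv n W \<phi> x b"
    have F: "?F \<in> carrier_mat (n (b - 1)) (n b)" "op_bound ?F (1 / sqrt (real (n b)))"
      using factor base by blast+
    have "backward_prod n W \<phi> x b b = ?F"
      by (simp add: backward_prod_def right_mult_one_mat[OF F(1)])
    with F show ?case
      by simp
  next
    case (step a)
    let ?F = "transpose_mat (scaled_weight n W a) * act_deriv n W \<phi> x a"
    have IH: "backward_prod n W \<phi> x (Suc a) b \<in> carrier_mat (n a) (n b)"
      "op_bound (backward_prod n W \<phi> x (Suc a) b) (1 / sqrt (real (n b)))"
      using step by auto
    have "?F \<in> carrier_mat (n (a - 1)) (n a)" "op_bound ?F (1 / sqrt (real (n a)))"
      using factor[of a] step(1,2,4,5) by auto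
    moreover have "1 / sqrt (real (n a)) \<le> 1"
      using n[of a] step by simp
    ultimately have F: "?F \<in> carrier_mat (n (a - 1)) (n a)" "op_bound ?F 1"
      using op_bound_mono by blast+
    have "backward_prod n W \<phi> x a b = ?F * backward_prod n W \<phi> x (Suc a) b"
      using step by (simp add: backward_prod_def upt_conv_Cons del: upt_Suc)
    then show ?case
      using op_bound_mult[OF F(1) IH(1) F(2) IH(2)] F IH by simp
  qed
qed

text \<open>The sum has \<open>Suc K - k\<close> terms, each of norm at most
  \<open>sqrt n\<^sub>o\<close> whatever the width of the layer where its shortcut starts.\<close>

lemma Delta_bound:
  assumes n: "\<And>l. l \<le> L \<Longrightarrow> 1 \<le> n l"
    and W: "\<And>l. l \<in> {1..L} \<Longrightarrow> W l \<in> carrier_mat (n l) (n (l - 1))"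
    and \<phi>: "well_posed C \<phi>" and stab: "\<And>l. l \<in> {1..L} \<Longrightarrow> stable_pertinent C (W l)"
    and h: "1 \<le> h" and KL: "K * h \<le> L" and k: "1 \<le> k" "k \<le> K"
  shows "Delta n n\<^sub>o W \<phi> h K x k \<in> carrier_mat (n (k * h - 1)) n\<^sub>o"
    "op_bound (Delta n n\<^sub>o W \<phi> h K x k) (real (Suc K - k) * sqrt (real n\<^sub>o))"
proof -
  let ?F = "\<lambda>j. backward_prod n W \<phi> x (k * h) (j * h) * transpose_mat (ones_mat n\<^sub>o (n (j * h)))"
  have F: "?F j \<in> carrier_mat (n (k * h - 1)) n\<^sub>o \<and> op_bound (?F j) (sqrt (real n\<^sub>o))"
    if j: "j \<in> set [k..<Suc K]" for j
  proof -
    have kj: "k * h \<le> j * h" "1 \<le> k * h"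
      using j k h by (auto simp: Suc_le_eq)
    have "j * h \<le> K * h"
      using j by (intro mult_le_mono1) auto
    with KL have jL: "j * h \<le> L"
      by linarith
    have P: "backward_prod n W \<phi> x (k * h) (j * h) \<in> carrier_mat (n (k * h - 1)) (n (j * h))"
      "op_bound (backward_prod n W \<phi> x (k * h) (j * h)) (1 / sqrt (real (n (j * h))))"
      using backward_prod_bound[where L = L and n = n and W = W, OF n W \<phi> stab kj jL] by auto
    have J: "transpose_mat (ones_mat n\<^sub>o (n (j * h))) \<in> carrier_mat (n (j * h)) n\<^sub>o"
      by (simp add: ones_mat_def)
    have J': "op_bound (transpose_mat (ones_mat n\<^sub>o (n (j * h)))) (sqrt (real n\<^sub>o) * sqrt (real (n (j * h))))"
      by (rule op_bound_transpose[OF _ op_bound_ones_mat]) (auto simp: ones_mat_def)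
    \<comment> \<open>Lets \<open>sqrt (n (j * h))\<close> from the shortcut cancel against its
      reciprocal from the backward product.\<close>
    have "0 < real (n (j * h))"
      using n[OF jL] by simp
    then show ?thesis
      using op_bound_mult[OF P(1) J P(2) J'] P J by simp
  qed
  show "Delta n n\<^sub>o W \<phi> h K x k \<in> carrier_mat (n (k * h - 1)) n\<^sub>o"
    "op_bound (Delta n n\<^sub>o W \<phi> h K x k) (real (Suc K - k) * sqrt (real n\<^sub>o))"
    using op_bound_foldr_add[of "[k..<Suc K]" ?F _ _ "\<lambda>_. sqrt (real n\<^sub>o)"] F
    by (auto simp: Delta_def map_replicate_const sum_list_replicate simp del: upt_Suc)
qed

section \<open>Summation over the shortcut levels and the final bound\<close>

lemma sum_list_squares_rev:
  "(\<Sum>k\<leftarrow>[1..<Suc K]. real (Suc K - k) ^ 2) = real (K * (K + 1) * (2 * K + 1)) / 6"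
proof -
  have "(\<Sum>k\<leftarrow>[1..<Suc K]. real (Suc K - k) ^ 2) = (\<Sum>k=1..K. real (Suc K - k) ^ 2)"
    by (simp only: interv_sum_list_conv_sum_set_nat set_upt atLeastLessThanSuc_atLeastAtMost)
  also have "\<dots> = (\<Sum>k=1..K. real k ^ 2)"
    \<comment> \<open>Reversing the order of summation is an involution on \<open>{1..K}\<close>,
      hence its own inverse witness.\<close>
    by (rule sum.reindex_bij_witness[where i = "\<lambda>k. Suc K - k" and j = "\<lambda>k. Suc K - k"]) auto
  also have "\<dots> = real (K * (K + 1) * (2 * K + 1)) / 6"
    by (induction K) (auto simp: algebra_simps power2_eq_square)
  finally show ?thesis .
qed

text \<open>For \<open>h = 1\<close> the first level of the kernel contains the inner product of the
  raw inputs, which the bound on \<open>\<phi>\<close> does not reach; there the squared input norms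
  are assumed to be at most \<open>d\<close>. For \<open>h \<ge> 2\<close> only layers from 1 on
  enter the inner products.\<close>

theorem theorem3:
  fixes L K h d n\<^sub>o :: nat
    and n :: "nat \<Rightarrow> nat"
    and W :: "nat \<Rightarrow> real mat"
    and \<phi> :: "real \<Rightarrow> real"
    and C :: real
    and x x' :: "real vec"
  assumes "1 \<le> h" and "1 \<le> K" and "K * h \<le> L"
    and "n 0 = d" and "\<And>l. l \<le> L \<Longrightarrow> 1 \<le> n l" and "1 \<le> n\<^sub>o"
    and "\<And>l. l \<in> {1..L} \<Longrightarrow> W l \<in> carrier_mat (n l) (n (l - 1))"
    and "well_posed C \<phi>"
    and "\<And>t. \<bar>\<phi> t\<bar> \<le> 1"
    and "\<And>l. l \<in> {1..L} \<Longrightarrow> stable_pertinent C (W l)"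
    and "x \<in> carrier_vec d" and "x' \<in> carrier_vec d"
    and "h = 1 \<Longrightarrow> scalar_prod x x \<le> real d \<and> scalar_prod x' x' \<le> real d"
  shows "sigma_max (NTK_d n n\<^sub>o W \<phi> h K x x')
           \<le> real (K * (2 * K + 1)) / 6 * real (n_max n n\<^sub>o L) ^ 2"
proof -
  note h = assms(1) and KL = assms(3) and n = assms(5) and W = assms(7) and \<phi> = assms(8)
    and bound = assms(9) and stab = assms(10)
  define N where "N = n_max n n\<^sub>o L"
  define M where "M = total_width n h K"
  have N: "n l \<le> N" if "l \<le> L" for l
    unfolding N_def n_max_def using that by (intro Max_ge) auto
  have "n\<^sub>o \<le> N"
    unfolding N_def n_max_def by (intro Max_ge) auto
  have "(\<Sum>k=0..K. 1) \<le> M"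
    unfolding M_def total_width_def
    using KL by (intro sum_mono n) (auto intro: order_trans[OF mult_le_mono1])
  then have M: "real K + 1 \<le> real M"
    by simp
  have kh: "1 \<le> k * h" "k * h \<le> L" if "k \<in> {1..K}" for k
    using that h KL by (auto intro: order_trans[OF mult_le_mono1] simp: Suc_le_eq)
  have z: "layer n W \<phi> y (k * h - 1) \<in> carrier_vec (n (k * h - 1)) \<and>
      vnorm (layer n W \<phi> y (k * h - 1)) \<le> sqrt (real N)"
    if k: "k \<in> {1..K}" and y: "y \<in> carrier_vec d" "h = 1 \<Longrightarrow> scalar_prod y y \<le> real d" for y k
  proof -
    have le: "sqrt (real (n (k * h - 1))) \<le> sqrt (real N)"
      using N[of "k * h - 1"] kh[OF k] by simp
    show ?thesis
    \<comment> \<open>The layer index \<open>k * h - 1\<close> is 0 only for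
      \<open>k = h = 1\<close>, where the assumption on the inputs takes the place of
      \<open>layer_bound\<close>.\<close>
    proof (cases "k * h = 1")
      case True
      then show ?thesis
        using y le assms(4) by (auto simp: vnorm_def)
    next
      case False
      then have "1 \<le> k * h - 1 \<and> k * h - 1 \<le> L"
        using kh[OF k] by linarith
      then have "k * h - 1 \<in> {1..L}"
        by (simp only: atLeastAtMost_iff)
      from layer_bound[where n = n and W = W and \<phi> = \<phi>, OF W bound this, of y] show ?thesis
        using le order_trans by blast
    qed
  qed
  \<comment> \<open>The part of each level's bound that is independent of \<open>k\<close>:
    \<open>N\<close> from the inner product of layers, \<open>n\<^sub>o\<close> from the two
    \<open>Delta\<close> factors, \<open>K + 1\<close> from the normalisation.\<close>
  define c where "c = real N * real n\<^sub>o / (real K + 1)"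
  have layer_term: "NTK_d_layer n n\<^sub>o W \<phi> h K x x' k \<in> carrier_mat n\<^sub>o n\<^sub>o \<and>
      op_bound (NTK_d_layer n n\<^sub>o W \<phi> h K x x' k) (real (Suc K - k) ^ 2 * c)"
    if k: "k \<in> set [1..<Suc K]" for k
  proof -
    have k': "k \<in> {1..K}" "1 \<le> k" "k \<le> K"
      using k by auto
    let ?z = "layer n W \<phi> x (k * h - 1)" and ?z' = "layer n W \<phi> x' (k * h - 1)"
    let ?D = "Delta n n\<^sub>o W \<phi> h K x k" and ?D' = "Delta n n\<^sub>o W \<phi> h K x' k"
    let ?b = "real (Suc K - k) * sqrt (real n\<^sub>o)"
    have D: "?D \<in> carrier_mat (n (k * h - 1)) n\<^sub>o" "op_bound ?D ?b"
      "?D' \<in> carrier_mat (n (k * h - 1)) n\<^sub>o" "op_bound ?D' ?b"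
      using Delta_bound[where L = L and n = n and W = W, OF n W \<phi> stab h KL k'(2,3)] by auto
    have DD: "op_bound (transpose_mat ?D * ?D') (?b * ?b)"
      using D by (intro op_bound_mult[of _ n\<^sub>o "n (k * h - 1)"] op_bound_transpose[OF D(1)]) auto
    have "\<bar>scalar_prod ?z ?z'\<bar> \<le> vnorm ?z * vnorm ?z'"
      using z[OF k'(1)] assms(11-13) by (intro scalar_prod_Cauchy_Schwarz) auto
    also have "\<dots> \<le> sqrt (real N) * sqrt (real N)"
      using z[OF k'(1)] assms(11-13) by (intro mult_mono) auto
    finally have "\<bar>1 / real M * scalar_prod ?z ?z'\<bar> \<le> real N / real M"
      by (simp add: abs_mult divide_right_mono)
    also have "\<dots> \<le> real N / (real K + 1)"
      using M by (intro divide_left_mono) auto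
    finally have "\<bar>1 / real M * scalar_prod ?z ?z'\<bar> * (?b * ?b) \<le> real N / (real K + 1) * (?b * ?b)"
      by (intro mult_right_mono) auto
    also have "\<dots> = real (Suc K - k) ^ 2 * c"
      by (simp add: c_def power2_eq_square)
    finally have "\<bar>1 / real M * scalar_prod ?z ?z'\<bar> * (?b * ?b) \<le> real (Suc K - k) ^ 2 * c" .
    then show ?thesis
      using op_bound_mono[OF op_bound_smult[OF DD]] D by (simp add: NTK_d_layer_def M_def)
  qed
  have NTK: "NTK_d n n\<^sub>o W \<phi> h K x x' \<in> carrier_mat n\<^sub>o n\<^sub>o"
    "op_bound (NTK_d n n\<^sub>o W \<phi> h K x x') (\<Sum>k\<leftarrow>[1..<Suc K]. real (Suc K - k) ^ 2 * c)"
    using op_bound_foldr_add[of "[1..<Suc K]" "NTK_d_layer n n\<^sub>o W \<phi> h K x x'" n\<^sub>o n\<^sub>o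
        "\<lambda>k. real (Suc K - k) ^ 2 * c"] layer_term
    unfolding NTK_d_def by simp_all
  have "sigma_max (NTK_d n n\<^sub>o W \<phi> h K x x') \<le> (\<Sum>k\<leftarrow>[1..<Suc K]. real (Suc K - k) ^ 2 * c)"
    using sigma_max_le[OF NTK(1) _ NTK(2)] assms(6) by simp
  also have "\<dots> = real (K * (K + 1) * (2 * K + 1)) / 6 * c"
    by (simp only: sum_list_mult_const sum_list_squares_rev)
  \<comment> \<open>The \<open>K + 1\<close> of the sum of squares cancels the denominator of
    \<open>c\<close>.\<close>
  also have "\<dots> = real (K * (2 * K + 1)) / 6 * (real N * real n\<^sub>o)"
    by (simp add: c_def field_simps)
  \<comment> \<open>The second factor \<open>N\<close> absorbs \<open>n\<^sub>o\<close>, as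
    \<open>n_max\<close> includes the output dimension.\<close>
  also have "\<dots> \<le> real (K * (2 * K + 1)) / 6 * real N ^ 2"
    using \<open>n\<^sub>o \<le> N\<close> by (intro mult_left_mono) (auto simp: power2_eq_square intro: mult_left_mono)
  finally show ?thesis
    by (simp add: N_def)
qed

end
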